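(* For every link $L$, $$f(L)\leq c(L).$$
   Context: $c(L)$ is the crossing number of $L$, the minimal number of crossing points $c(D)$ over all diagrams $D$ of $L$. $f(L)=\min\{d(D)+d(-D)+sr(D)\mid D \text{ a diagram of } L\}$, where diagrams are given an orientation (the value $d(D)+d(-D)$ does not depend on which), $-D$ is $D$ with the orientations of all components reversed, and $sr(D)$ is the number of components $D^i$ of $D$ having at least one self-crossing (a crossing both of whose strands belong to the same component). Warping degree. A base point sequence ${\bf a}=(a_1,\dots,a_r)$ of an oriented link diagram $D$ with $r$ components is an ordered sequence of points, exactly one on each component, none at a crossing point; the order of ${\bf a}$ determines the order of the components, and we write $D_{\bf a}=D^1_{a_1}\cup\dots\cup D^r_{a_r}$. A self-crossing $p$ of $D^i$ is a warping crossing point of $D^i_{a_i}$ if, travelling along the oriented $D^i$ starting from $a_i$, one meets $p$ first at its under-crossing. For $i<j$, a crossing point $p$ of $D^i$ and $D^j$ is a warping crossing point between $D^i_{a_i}$ and $D^j_{a_j}$ if $D^i$ is the under-strand at $p$. $d(D_{\bf a})$ is the total number of warping crossing points of $D_{\bf a}$ (of both kinds), and $d(D)=\min_{\bf a} d(D_{\bf a})$ over all base point sequences ${\bf a}$ (including all orders of the components). *)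

theory Defs
  imports "HOL-Analysis.Analysis"
begin

text \<open>
  An oriented circle is parametrised by a 1-periodic function on the reals. A finite ordered
  family of parametrised circles is a list of such functions, and a pair \<open>(i, t)\<close> with
  \<open>0 \<le> t < 1\<close> names the point with parameter \<open>t\<close> of the \<open>i\<close>-th circle (before mapping it into
  the plane or into space).
\<close>

definition smooth_curve :: "(real \<Rightarrow> 'a::real_normed_vector) \<Rightarrow> bool" where
  "smooth_curve \<gamma> \<longleftrightarrow>
     (\<forall>k t. ((\<lambda>g t. vector_derivative g (at t)) ^^ k) \<gamma> differentiable at t)"

definition closed_immersion :: "(real \<Rightarrow> 'a::real_normed_vector) \<Rightarrow> bool" where
  "closed_immersion \<gamma> \<longleftrightarrow>
     smooth_curve \<gamma> \<and> (\<forall>t. \<gamma> (t + 1) = \<gamma> t) \<and> (\<forall>t. vector_derivative \<gamma> (at t) \<noteq> 0)"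

definition strands :: "(real \<Rightarrow> 'a) list \<Rightarrow> (nat \<times> real) set" where
  "strands \<gamma>s = {..<length \<gamma>s} \<times> {0..<1}"

definition point :: "(real \<Rightarrow> 'a) list \<Rightarrow> nat \<times> real \<Rightarrow> 'a" where
  "point \<gamma>s s = (\<gamma>s ! fst s) (snd s)"

definition velocity :: "(real \<Rightarrow> 'a::real_normed_vector) list \<Rightarrow> nat \<times> real \<Rightarrow> 'a" where
  "velocity \<gamma>s s = vector_derivative (\<gamma>s ! fst s) (at (snd s))"


section \<open>Links\<close>

definition embedded_circles :: "(real \<Rightarrow> real ^ 3) list \<Rightarrow> bool" where
  "embedded_circles \<gamma>s \<longleftrightarrow>
     \<gamma>s \<noteq> [] \<and> (\<forall>\<gamma> \<in> set \<gamma>s. closed_immersion \<gamma>) \<and> inj_on (point \<gamma>s) (strands \<gamma>s)"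

definition ambient_isotopic :: "(real ^ 3) set \<Rightarrow> (real ^ 3) set \<Rightarrow> bool" where
  "ambient_isotopic K L \<longleftrightarrow>
     (\<exists>h. homotopic_with_canon (\<lambda>f. \<exists>g. homeomorphism UNIV UNIV f g) UNIV UNIV id h \<and> h ` K = L)"

text \<open>
  Links are unoriented and tame. Closing up under ambient isotopy makes the notion independent
  of the choice between smooth and polygonal links.
\<close>

definition link :: "(real ^ 3) set \<Rightarrow> bool" where
  "link L \<longleftrightarrow>
     (\<exists>\<gamma>s. embedded_circles \<gamma>s \<and> ambient_isotopic (point \<gamma>s ` strands \<gamma>s) L)"


section \<open>Oriented link diagrams\<close>

text \<open>
  A diagram consists of oriented closed curves in the plane together with the choice, at each
  crossing point \<open>p\<close>, of the strand \<open>over D p\<close> passing over. The values of \<open>over D\<close> away from the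
  crossing points are irrelevant.
\<close>

record diagram =
  curves :: "(real \<Rightarrow> real ^ 2) list"
  over :: "real ^ 2 \<Rightarrow> nat \<times> real"

definition strands_at :: "diagram \<Rightarrow> real ^ 2 \<Rightarrow> (nat \<times> real) set" where
  "strands_at D p = {s \<in> strands (curves D). point (curves D) s = p}"

definition crossings :: "diagram \<Rightarrow> (real ^ 2) set" where
  "crossings D = {p. \<exists>s \<in> strands_at D p. \<exists>s' \<in> strands_at D p. s \<noteq> s'}"

definition under :: "diagram \<Rightarrow> real ^ 2 \<Rightarrow> nat \<times> real" where
  "under D p = (THE s. s \<in> strands_at D p \<and> s \<noteq> over D p)"

text \<open>Finitely many multiple points, all of them transverse double points.\<close>

definition link_diagram :: "diagram \<Rightarrow> bool" where
  "link_diagram D \<longleftrightarrow>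
     curves D \<noteq> [] \<and> (\<forall>\<gamma> \<in> set (curves D). closed_immersion \<gamma>) \<and>
     finite (crossings D) \<and>
     (\<forall>p \<in> crossings D. card (strands_at D p) = 2 \<and> over D p \<in> strands_at D p \<and>
        \<not> collinear {0, velocity (curves D) (over D p), velocity (curves D) (under D p)})"

text \<open>
  \<open>D\<close> is a diagram of \<open>L\<close> if it is the projection, along the third coordinate, of a link that is
  ambient isotopic to \<open>L\<close>. All orientations of the components and all parametrisations are
  allowed.
\<close>

definition diagram_of :: "diagram \<Rightarrow> (real ^ 3) set \<Rightarrow> bool" where
  "diagram_of D L \<longleftrightarrow>
     link_diagram D \<and>
     (\<exists>\<gamma>s. embedded_circles \<gamma>s \<and> ambient_isotopic (point \<gamma>s ` strands \<gamma>s) L \<and>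
        length (curves D) = length \<gamma>s \<and>
        (\<forall>i < length \<gamma>s. \<forall>t. (curves D ! i) t = vector [(\<gamma>s ! i) t $ 1, (\<gamma>s ! i) t $ 2]) \<and>
        (\<forall>p \<in> crossings D. point \<gamma>s (under D p) $ 3 < point \<gamma>s (over D p) $ 3))"

text \<open>The parameter \<open>t\<close> of a point becomes \<open>- t\<close>, taken modulo 1, when orientations are reversed.\<close>

definition reverse_diagram :: "diagram \<Rightarrow> diagram" where
  "reverse_diagram D =
     \<lparr>curves = map (\<lambda>\<gamma> t. \<gamma> (- t)) (curves D),
      over = (\<lambda>p. (fst (over D p), frac (- snd (over D p))))\<rparr>"


section \<open>Warping degree\<close>

text \<open>
  A base point sequence lists the base points in their order: the \<open>k\<close>-th entry \<open>(i, t)\<close> is the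
  base point of the component with index \<open>i\<close>, which thereby becomes the \<open>k\<close>-th component of
  the diagram. This order is arbitrary, and unrelated to the order of the list \<open>curves D\<close>.
\<close>

definition base_sequence :: "diagram \<Rightarrow> (nat \<times> real) list \<Rightarrow> bool" where
  "base_sequence D as \<longleftrightarrow>
     set as \<subseteq> strands (curves D) \<and>
     distinct (map fst as) \<and> set (map fst as) = {..<length (curves D)} \<and>
     (\<forall>s \<in> set as. point (curves D) s \<notin> crossings D)"

text \<open>\<open>frac (t - a)\<close> is the time needed to travel from parameter \<open>a\<close> to parameter \<open>t\<close>.\<close>

definition self_warping :: "diagram \<Rightarrow> nat \<times> real \<Rightarrow> (real ^ 2) set" where
  "self_warping D s =
     {p \<in> crossings D. fst (over D p) = fst s \<and> fst (under D p) = fst s \<and>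
        frac (snd (under D p) - snd s) < frac (snd (over D p) - snd s)}"

definition mixed_warping :: "diagram \<Rightarrow> nat \<times> real \<Rightarrow> nat \<times> real \<Rightarrow> (real ^ 2) set" where
  "mixed_warping D s s' =
     {p \<in> crossings D. fst (under D p) = fst s \<and> fst (over D p) = fst s'}"

definition warping_crossings :: "diagram \<Rightarrow> (nat \<times> real) list \<Rightarrow> (real ^ 2) set" where
  "warping_crossings D as =
     (\<Union>k < length as. self_warping D (as ! k)) \<union>
     (\<Union>l < length as. \<Union>k < l. mixed_warping D (as ! k) (as ! l))"

definition warping_degree :: "diagram \<Rightarrow> nat" where
  "warping_degree D = (INF as \<in> {as. base_sequence D as}. card (warping_crossings D as))"

definition self_crossing_components :: "diagram \<Rightarrow> nat" where
  "self_crossing_components D =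
     card {i. \<exists>p \<in> crossings D. fst (over D p) = i \<and> fst (under D p) = i}"


section \<open>Link invariants\<close>

text \<open>An infimum of a nonempty set of natural numbers is its minimum; every link has a diagram.\<close>

definition crossing_number :: "(real ^ 3) set \<Rightarrow> nat" where
  "crossing_number L = (INF D \<in> {D. diagram_of D L}. card (crossings D))"

definition warping_invariant :: "(real ^ 3) set \<Rightarrow> nat" where
  "warping_invariant L =
     (INF D \<in> {D. diagram_of D L}.
        warping_degree D + warping_degree (reverse_diagram D) + self_crossing_components D)"

end

theory Submission
  imports Defs
begin

text \<open>
  Both sides are infima over the same set of diagrams, so it suffices to show
  \<open>d(D) + d(-D) + sr(D) \<le> c(D)\<close> for every single diagram \<open>D\<close> (lemma
  \<open>warping_degrees_le_crossings\<close>).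

  On each component with a self-crossing choose one self-crossing \<open>p\<close>, and travel along \<open>D\<close> from a
  base point just before the over-strand of \<open>p\<close>, but along \<open>-D\<close> from a base point just behind it
  (in terms of the orientation of \<open>D\<close>). Order the components in one way for \<open>D\<close> and in the
  opposite way for \<open>-D\<close>. Then no crossing is warping for both choices. For crossings between
  different components this is due to the opposite orders. At a self-crossing other than \<open>p\<close> the two
  journeys meet the two strands in opposite orders, since the short arc between the two base points
  contains no crossing but \<open>p\<close>. Finally, \<open>p\<close> itself is warping for neither choice, because both
  journeys start with its over-strand. So the two sets of warping crossings and the set of the
  selected crossings \<open>p\<close>, of which there are \<open>sr(D)\<close>, are pairwise disjoint sets of crossings.
\<close>

section \<open>Travel times around the circle\<close>

text \<open>
  Base points are placed at distance \<open>e\<close> from a parameter \<open>t\<close>. If \<open>u\<close> is at \<open>t\<close>, or not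
  passed when moving the base point away from \<open>t\<close>, the time needed to reach \<open>u\<close> is that from \<open>t\<close>,
  increased by \<open>e\<close>. For reversed orientation the time from \<open>t\<close> is \<open>1 - frac (u - t)\<close>, except that it
  is \<open>0\<close> for \<open>u = t\<close>: this exception makes the over-strand at \<open>t\<close> come first in both directions.
\<close>

lemma frac_diff_frac_before:
  fixes t u e :: real
  assumes "0 < e" and "e < 1" and "frac (u - t) = 0 \<or> frac (u - t) < 1 - e"
  shows "frac (u - frac (t - e)) = frac (u - t) + e"
proof -
  have "u - frac (t - e) - (frac (u - t) + e) = of_int (\<lfloor>t - e\<rfloor> + \<lfloor>u - t\<rfloor>)"
    by (simp add: frac_def)
  then have "u - frac (t - e) - (frac (u - t) + e) \<in> \<int>"
    by (metis Ints_of_int)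
  moreover have "0 \<le> frac (u - t) + e" "frac (u - t) + e < 1"
    using assms frac_ge_0[of "u - t"] by linarith+
  ultimately show ?thesis
    by (simp add: frac_unique_iff)
qed

lemma frac_diff_frac_behind:
  fixes t u e :: real
  assumes "0 < e" and "e < 1" and "frac (u - t) = 0 \<or> e < frac (u - t)"
  shows "frac (frac (- u) - frac (- (t + e))) =
    (if frac (u - t) = 0 then e else 1 - frac (u - t) + e)" (is "_ = ?r")
proof -
  have "frac (- u) - frac (- (t + e)) - ?r
      = of_int (\<lfloor>- (t + e)\<rfloor> - \<lfloor>- u\<rfloor> - \<lfloor>u - t\<rfloor> - (if frac (u - t) = 0 then 0 else 1))"
    by (simp add: frac_def)
  then have "frac (- u) - frac (- (t + e)) - ?r \<in> \<int>"
    by (metis Ints_of_int)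
  moreover have "0 \<le> ?r" "?r < 1"
    using assms frac_lt_1[of "u - t"] by (auto simp del: frac_eq_0_iff)
  ultimately show ?thesis
    by (simp add: frac_unique_iff)
qed

lemma frac_diff_eq_0_iff:
  fixes t u :: real
  assumes "t \<in> {0..<1}" and "u \<in> {0..<1}"
  shows "frac (u - t) = 0 \<longleftrightarrow> u = t"
proof
  assume "frac (u - t) = 0"
  then obtain k where "u - t = of_int k"
    by (auto elim: Ints_cases)
  moreover from this have "k = 0"
    using assms by auto
  ultimately show "u = t"
    by simp
qed simp

lemma frac_minus_frac_minus:
  fixes t :: real
  shows "frac (- frac (- t)) = frac t"
  by (simp add: frac_unique_iff frac_lt_1) (simp add: frac_def)

lemma isolating_distance:
  fixes t :: real
  assumes "finite T"
  obtains e where "0 < e" "e < 1"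
    "\<And>u. u \<in> T \<Longrightarrow> frac (u - t) = 0 \<or> e < frac (u - t) \<and> frac (u - t) < 1 - e"
proof -
  have below: "eventually (\<lambda>e::real. e < c) (at_right 0)" if "0 < c" for c
    using that by (auto simp: eventually_at_right_field)
  have "eventually (\<lambda>e. frac (u - t) = 0 \<or> e < frac (u - t) \<and> frac (u - t) < 1 - e) (at_right 0)"
    for u
  proof (cases "frac (u - t) = 0")
    case False
    then have "0 < frac (u - t)" "0 < 1 - frac (u - t)"
      using frac_ge_0[of "u - t"] frac_lt_1[of "u - t"] by linarith+
    then show ?thesis
      by (auto intro: eventually_elim2[OF below[of "frac (u - t)"] below[of "1 - frac (u - t)"]])
  qed simp
  then have "eventually (\<lambda>e. \<forall>u\<in>T. frac (u - t) = 0 \<or> e < frac (u - t) \<and> frac (u - t) < 1 - e)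
      (at_right 0)"
    using assms by (simp add: eventually_ball_finite_distrib del: frac_eq_0_iff)
  moreover have "eventually (\<lambda>e::real. 0 < e) (at_right 0)"
    by (rule eventually_at_right_less)
  ultimately have "eventually (\<lambda>e. 0 < e \<and> e < 1 \<and>
      (\<forall>u\<in>T. frac (u - t) = 0 \<or> e < frac (u - t) \<and> frac (u - t) < 1 - e)) (at_right 0)"
    using below[OF zero_less_one] by eventually_elim blast
  then show thesis
    using that by (auto dest!: eventually_happens simp: trivial_limit_at_right_real)
qed


section \<open>Crossings and orientation reversal\<close>

lemma strands_at_crossing:
  assumes "link_diagram D" and "p \<in> crossings D"
  shows "strands_at D p = {over D p, under D p}" and "over D p \<noteq> under D p"
proof -
  have over: "card (strands_at D p) = 2" "over D p \<in> strands_at D p"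
    using assms by (auto simp: link_diagram_def)
  then have "card (strands_at D p - {over D p}) = 1"
    by simp
  then obtain s where "strands_at D p - {over D p} = {s}"
    by (rule card_1_singletonE)
  then have s: "strands_at D p = {over D p, s}" "s \<noteq> over D p"
    using over(2) by blast+
  then have "under D p = s"
    unfolding under_def by (intro the_equality) auto
  then show "strands_at D p = {over D p, under D p}" and "over D p \<noteq> under D p"
    using s by auto
qed

lemma finite_crossing_strands:
  assumes "link_diagram D"
  shows "finite (\<Union>p \<in> crossings D. strands_at D p)"
  using assms strands_at_crossing(1)[OF assms] by (auto simp: link_diagram_def)

definition reverse_strand :: "nat \<times> real \<Rightarrow> nat \<times> real" where
  "reverse_strand s = (fst s, frac (- snd s))"

lemma fst_reverse_strand [simp]: "fst (reverse_strand s) = fst s"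
  by (simp add: reverse_strand_def)

lemma reverse_strand_in_strands [simp]:
  "reverse_strand s \<in> strands \<gamma>s \<longleftrightarrow> fst s < length \<gamma>s"
  by (auto simp: reverse_strand_def strands_def frac_lt_1)

lemma reverse_strand_involution:
  "s \<in> strands \<gamma>s \<Longrightarrow> reverse_strand (reverse_strand s) = s"
  by (auto simp: reverse_strand_def strands_def frac_minus_frac_minus frac_eq)

lemma strands_reverse [simp]: "strands (curves (reverse_diagram D)) = strands (curves D)"
  by (simp add: reverse_diagram_def strands_def)

lemma over_reverse [simp]: "over (reverse_diagram D) p = reverse_strand (over D p)"
  by (simp add: reverse_diagram_def reverse_strand_def)

lemma closed_immersion_frac:
  assumes "closed_immersion \<gamma>"
  shows "\<gamma> (frac t) = \<gamma> t"
proof -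
  interpret periodic_fun_simple' \<gamma>
    using assms by unfold_locales (simp add: closed_immersion_def)
  show ?thesis
    using minus_of_int[of t "\<lfloor>t\<rfloor>"] by (simp add: frac_def)
qed

lemma point_reverse:
  assumes "link_diagram D" and "s \<in> strands (curves D)"
  shows "point (curves (reverse_diagram D)) s = point (curves D) (reverse_strand s)"
proof -
  have "fst s < length (curves D)"
    using assms(2) by (auto simp: strands_def)
  moreover from this have "closed_immersion (curves D ! fst s)"
    using assms(1) by (simp add: link_diagram_def)
  ultimately show ?thesis
    by (simp add: point_def reverse_diagram_def reverse_strand_def closed_immersion_frac)
qed

lemma strands_at_reverse:
  assumes "link_diagram D"
  shows "strands_at (reverse_diagram D) p = reverse_strand ` strands_at D p" (is "?A = ?B")
proof (intro set_eqI iffI)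
  fix s assume "s \<in> ?A"
  then have s: "s \<in> strands (curves D)" "point (curves D) (reverse_strand s) = p"
    using point_reverse[OF assms, of s] by (auto simp: strands_at_def)
  then have "reverse_strand s \<in> strands_at D p"
    by (auto simp: strands_at_def) (auto simp: strands_def)
  then show "s \<in> ?B"
    using reverse_strand_involution[OF s(1)] by (metis imageI)
next
  fix s assume "s \<in> ?B"
  then obtain s' where s': "s = reverse_strand s'" "s' \<in> strands (curves D)" "point (curves D) s' = p"
    by (auto simp: strands_at_def)
  then have "s \<in> strands (curves D)"
    by (auto simp: strands_def reverse_strand_def frac_lt_1)
  then show "s \<in> ?A"
    using s' point_reverse[OF assms] reverse_strand_involution[OF s'(2)]
    by (simp add: strands_at_def)
qed

lemma inj_on_reverse_strand: "inj_on reverse_strand (strands \<gamma>s)"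
  by (rule inj_on_inverseI) (rule reverse_strand_involution)

lemma crossings_reverse:
  assumes "link_diagram D"
  shows "crossings (reverse_diagram D) = crossings D"
proof -
  have "reverse_strand s = reverse_strand s' \<longleftrightarrow> s = s'"
    if "s \<in> strands_at D p" "s' \<in> strands_at D p" for s s' p
    using that inj_on_eq_iff[OF inj_on_reverse_strand[of "curves D"], of s s']
    by (auto simp: strands_at_def)
  then show ?thesis
    unfolding crossings_def strands_at_reverse[OF assms] by (simp cong: bex_cong)
qed

lemma under_reverse:
  assumes "link_diagram D" and "p \<in> crossings D"
  shows "under (reverse_diagram D) p = reverse_strand (under D p)"
proof -
  note two = strands_at_crossing[OF assms]
  have "over D p \<in> strands (curves D)" "under D p \<in> strands (curves D)"
    using two(1) by (auto simp: strands_at_def)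
  then have "reverse_strand (under D p) \<noteq> reverse_strand (over D p)"
    using two(2)[symmetric] by (simp add: inj_on_eq_iff[OF inj_on_reverse_strand[of "curves D"]])
  then show ?thesis
    unfolding under_def[of "reverse_diagram D"] strands_at_reverse[OF assms(1)] two(1)
    by (intro the_equality) auto
qed


section \<open>Disjoint sets of warping crossings\<close>

text \<open>
  The parameter near which the base points will be placed. It belongs to the over-strand of a
  self-crossing, if there is one. That it is no under-strand of a self-crossing is a consequence,
  and essential: such a crossing would be met first at its under-strand in both directions.
\<close>

lemma over_parameter_of_self_crossing:
  assumes "link_diagram D"
  obtains t where "t \<in> {0..<1}"
    "\<And>p. p \<in> crossings D \<Longrightarrow> fst (over D p) = i \<Longrightarrow> fst (under D p) = i \<Longrightarrow>
      under D p \<noteq> (i, t) \<and> (\<exists>q \<in> crossings D. over D q = (i, t) \<and> fst (under D q) = i)"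
proof (cases "\<exists>q \<in> crossings D. fst (over D q) = i \<and> fst (under D q) = i")
  case True
  then obtain q where q: "q \<in> crossings D" "fst (over D q) = i" "fst (under D q) = i"
    by blast
  let ?t = "snd (over D q)"
  have over: "over D q \<in> strands_at D q"
    using strands_at_crossing(1)[OF assms q(1)] by simp
  have "under D p \<noteq> (i, ?t)" if p: "p \<in> crossings D" for p
  proof
    assume "under D p = (i, ?t)"
    then have "under D p = over D q"
      using q(2) by (simp add: prod_eq_iff)
    moreover have "under D p \<in> strands_at D p"
      using strands_at_crossing(1)[OF assms p] by simp
    \<comment> \<open>a strand lies over a single point of the plane\<close>
    ultimately have "p = q"
      using over by (simp add: strands_at_def)
    with \<open>under D p = over D q\<close> show False
      using strands_at_crossing(2)[OF assms p] by simp
  qed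
  moreover have "?t \<in> {0..<1}"
    using over by (auto simp: strands_at_def strands_def)
  moreover have "over D q = (i, ?t)"
    using q(2) by (simp add: prod_eq_iff)
  ultimately show thesis
    using q by (intro that[of ?t]) blast+
next
  case False
  then show thesis
    by (intro that[of 0]) auto
qed

text \<open>
  The base points are \<open>(i, t i - e i)\<close> in \<open>D\<close> and, expressed by parameters of \<open>D\<close>, \<open>(i, t i + e i)\<close>
  in \<open>-D\<close>. The facts \<open>W\<close> and \<open>R\<close> of the proof translate what it means to be warping for them into
  travel times from \<open>t i\<close> in the direction of \<open>D\<close>. They contradict each other unless the under-strand of
  a self-crossing passes \<open>t i\<close>, and neither holds for a self-crossing whose over-strand passes \<open>t i\<close>.
\<close>

theorem warping_degrees_le_crossings:
  assumes D: "link_diagram D"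
  shows "warping_degree D + warping_degree (reverse_diagram D) + self_crossing_components D
    \<le> card (crossings D)"
proof -
  define n where "n = length (curves D)"
  have "\<exists>t. t \<in> {0..<1} \<and> (\<forall>p \<in> crossings D. fst (over D p) = i \<longrightarrow> fst (under D p) = i \<longrightarrow>
      under D p \<noteq> (i, t) \<and> (\<exists>q \<in> crossings D. over D q = (i, t) \<and> fst (under D q) = i))" for i
    by (rule over_parameter_of_self_crossing[OF D, of i]) blast
  then obtain t where t01: "t i \<in> {0..<1}" and
    t: "\<And>p. p \<in> crossings D \<Longrightarrow> fst (over D p) = i \<Longrightarrow> fst (under D p) = i \<Longrightarrow>
      under D p \<noteq> (i, t i) \<and> (\<exists>q \<in> crossings D. over D q = (i, t i) \<and> fst (under D q) = i)" for i
    by metis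
  \<comment> \<open>the parameters of all crossings on component \<open>i\<close>, including those with other components\<close>
  define T where "T i = {u. \<exists>p \<in> crossings D. (i, u) \<in> strands_at D p}" for i
  have "finite (T i)" for i
  proof -
    have "T i = Pair i -` (\<Union>p \<in> crossings D. strands_at D p)"
      by (auto simp: T_def)
    then show ?thesis
      using finite_crossing_strands[OF D] by (simp add: finite_vimageI inj_def)
  qed
  then have "\<exists>e. 0 < e \<and> e < 1 \<and> (\<forall>u \<in> T i.
      frac (u - t i) = 0 \<or> e < frac (u - t i) \<and> frac (u - t i) < 1 - e)" for i
    by (rule isolating_distance[of "T i" "t i"]) blast
  then obtain e where e: "0 < e i" "e i < 1" and
    gap: "\<And>u. u \<in> T i \<Longrightarrow>
      frac (u - t i) = 0 \<or> e i < frac (u - t i) \<and> frac (u - t i) < 1 - e i" for i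
    by metis
  have T01: "u \<in> {0..<1}" if "u \<in> T i" for u i
    using that by (auto simp: T_def strands_at_def strands_def)
  have over_T: "snd (over D p) \<in> T (fst (over D p))"
    and under_T: "snd (under D p) \<in> T (fst (under D p))" if "p \<in> crossings D" for p
    using that strands_at_crossing(1)[OF D that] by (auto simp: T_def)

  define a where "a i = (i, frac (t i - e i))" for i
  define b where "b i = (i, frac (- (t i + e i)))" for i
  define as where "as = map a [0..<n]"
  define bs where "bs = rev (map b [0..<n])"
  have [simp]: "length as = n" "length bs = n"
    by (simp_all add: as_def bs_def)
  have as_nth: "as ! k = a k" and bs_nth: "bs ! k = b (n - Suc k)" if "k < n" for k
    using that by (simp_all add: as_def bs_def rev_nth)

  have off_crossings: "point (curves D) (i, u) \<notin> crossings D"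
    if "i < n" "u \<in> {0..<1}" "frac (u - t i) \<noteq> 0" "frac (u - t i) = e i \<or> frac (u - t i) = 1 - e i"
    for i u
  proof
    assume "point (curves D) (i, u) \<in> crossings D"
    then have "u \<in> T i"
      using that by (auto simp: T_def strands_at_def strands_def n_def)
    from gap[OF this] show False
      using that by auto
  qed
  have "point (curves D) (a i) \<notin> crossings D" if "i < n" for i
  proof -
    have "frac (frac (t i - e i) - t i) = 1 - e i"
      using e[of i] by (simp add: frac_unique_iff) (simp add: frac_def)
    then show ?thesis
      unfolding a_def using e[of i] that
      by (intro off_crossings) (auto simp: frac_lt_1 simp del: frac_eq_0_iff)
  qed
  then have "base_sequence D as"
    by (auto simp: base_sequence_def as_def a_def strands_def n_def frac_lt_1 o_def)
  then have dD: "warping_degree D \<le> card (warping_crossings D as)"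
    unfolding warping_degree_def by (intro cINF_lower) auto

  have "point (curves (reverse_diagram D)) (b i) \<notin> crossings D" if "i < n" for i
  proof -
    have "b i \<in> strands (curves D)"
      using that by (auto simp: b_def strands_def n_def frac_lt_1)
    moreover have "reverse_strand (b i) = (i, frac (t i + e i))"
      using frac_minus_frac_minus[of "t i + e i"] by (simp add: b_def reverse_strand_def)
    ultimately have "point (curves (reverse_diagram D)) (b i) = point (curves D) (i, frac (t i + e i))"
      by (simp add: point_reverse[OF D])
    moreover have "frac (frac (t i + e i) - t i) = e i"
      using e[of i] by (simp add: frac_unique_iff) (simp add: frac_def)
    ultimately show ?thesis
      using e[of i] that off_crossings[of i "frac (t i + e i)"]
      by (auto simp: frac_lt_1 simp del: frac_eq_0_iff)
  qed
  moreover have "length (curves (reverse_diagram D)) = n"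
    by (simp add: reverse_diagram_def n_def)
  ultimately have "base_sequence (reverse_diagram D) bs"
    using crossings_reverse[OF D]
    by (auto simp: base_sequence_def bs_def b_def strands_def n_def frac_lt_1 o_def rev_map[symmetric])
  then have dR: "warping_degree (reverse_diagram D) \<le> card (warping_crossings (reverse_diagram D) bs)"
    unfolding warping_degree_def by (intro cINF_lower) auto

  let ?from_t = "\<lambda>i s. frac (snd s - t i)"
  have W: "fst (under D p) < fst (over D p) \<or>
      fst (under D p) = fst (over D p) \<and>
      ?from_t (fst (over D p)) (under D p) < ?from_t (fst (over D p)) (over D p)"
    if "p \<in> warping_crossings D as" for p
  proof -
    have p: "p \<in> crossings D"
      using that by (auto simp: warping_crossings_def self_warping_def mixed_warping_def)
    have "frac (u - frac (t i - e i)) = frac (u - t i) + e i" if "u \<in> T i" for u i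
      using gap[OF that] e[of i] by (intro frac_diff_frac_before) auto
    then show ?thesis
      using that over_T[OF p] under_T[OF p]
      by (auto simp: warping_crossings_def self_warping_def mixed_warping_def as_nth a_def
          simp del: frac_eq_0_iff)
  qed
  have R: "fst (over D p) < fst (under D p) \<or>
      fst (under D p) = fst (over D p) \<and>
      ?from_t (fst (over D p)) (over D p) \<noteq> 0 \<and>
      (?from_t (fst (over D p)) (under D p) = 0 \<or>
       ?from_t (fst (over D p)) (over D p) < ?from_t (fst (over D p)) (under D p))"
    if R: "p \<in> warping_crossings (reverse_diagram D) bs" for p
  proof -
    have p: "p \<in> crossings D"
      using R crossings_reverse[OF D]
      by (auto simp: warping_crossings_def self_warping_def mixed_warping_def)
    have travel: "frac (frac (- u) - frac (- (t i + e i))) =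
        (if frac (u - t i) = 0 then e i else 1 - frac (u - t i) + e i)" if "u \<in> T i" for u i
      using gap[OF that] e[of i] by (intro frac_diff_frac_behind) auto
    consider (self) i where "fst (over D p) = i" "fst (under D p) = i"
        "frac (frac (- snd (under D p)) - frac (- (t i + e i)))
          < frac (frac (- snd (over D p)) - frac (- (t i + e i)))"
      | (mixed) "fst (over D p) < fst (under D p)"
      using R
      by (auto simp: warping_crossings_def self_warping_def mixed_warping_def bs_nth b_def
          under_reverse[OF D p] reverse_strand_def simp del: minus_add_distrib)
    then show ?thesis
    proof cases
      case self
      then show ?thesis
        using travel[of "snd (under D p)" i] travel[of "snd (over D p)" i] over_T[OF p] under_T[OF p]
          frac_lt_1[of "snd (under D p) - t i"]
        by (auto split: if_splits simp del: frac_eq_0_iff)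
    qed simp
  qed

  \<comment> \<open>select one self-crossing on each component that has any\<close>
  define S where "S = {i. \<exists>p \<in> crossings D. fst (over D p) = i \<and> fst (under D p) = i}"
  have "\<forall>i \<in> S. \<exists>q \<in> crossings D. over D q = (i, t i) \<and> fst (under D q) = i"
    using t by (auto simp: S_def)
  then obtain q where q: "\<And>i. i \<in> S \<Longrightarrow> q i \<in> crossings D \<and> over D (q i) = (i, t i) \<and> fst (under D (q i)) = i"
    by metis
  have "inj_on q S"
    by (rule inj_onI) (metis q fst_conv)
  then have sr: "self_crossing_components D = card (q ` S)"
    by (simp add: card_image self_crossing_components_def S_def)

  let ?W = "warping_crossings D as" and ?R = "warping_crossings (reverse_diagram D) bs"
  have sub: "?W \<subseteq> crossings D" "?R \<subseteq> crossings D" "q ` S \<subseteq> crossings D"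
    using q crossings_reverse[OF D]
    by (auto simp: warping_crossings_def self_warping_def mixed_warping_def)
  have "p \<notin> ?R" if p: "p \<in> ?W" for p
  proof
    assume "p \<in> ?R"
    from W[OF p] R[OF this] have i: "fst (under D p) = fst (over D p)"
      and "?from_t (fst (over D p)) (under D p) = 0"
      by auto
    moreover have c: "p \<in> crossings D"
      using sub p by blast
    ultimately have "snd (under D p) = t (fst (over D p))"
      using frac_diff_eq_0_iff[OF t01 T01[OF under_T[OF c]]] by simp
    then show False
      using t[OF c refl i] i by (simp add: prod_eq_iff)
  qed
  moreover have "q i \<notin> ?W" "q i \<notin> ?R" if "i \<in> S" for i
    using W[of "q i"] R[of "q i"] q[OF that] frac_ge_0[of "snd (under D (q i)) - t i"] by auto
  ultimately have disj: "?W \<inter> ?R = {}" "(?W \<union> ?R) \<inter> q ` S = {}"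
    by auto
  have fin: "finite (crossings D)"
    using D by (simp add: link_diagram_def)
  have "card ?W + card ?R + card (q ` S) = card (?W \<union> ?R \<union> q ` S)"
    using disj sub finite_subset[OF _ fin] by (simp add: card_Un_disjoint)
  also have "\<dots> \<le> card (crossings D)"
    using sub fin by (intro card_mono) auto
  finally show ?thesis
    using dD dR sr by linarith
qed

theorem corollary5p5:
  assumes "link L"
  shows "warping_invariant L \<le> crossing_number L"
proof (cases "{D. diagram_of D L} = {}")
  case False
  then show ?thesis
    unfolding warping_invariant_def crossing_number_def
    by (intro cINF_mono) (auto simp: diagram_of_def intro: warping_degrees_le_crossings)
next
  \<comment> \<open>without diagrams, both sides are the infimum of the empty set\<close>
  case True
  then show ?thesis
    by (simp add: warping_invariant_def crossing_number_def)
qed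

end
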